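(* Let $\{G_n\}_{n\ge 1}$ be a strictly increasing sequence of positive integers with $G_1=1$ satisfying $G_n=\alpha_1G_{n-1}+\cdots+\alpha_dG_{n-d}$ for all $n>d$, with constant coefficients $\alpha_1,\dots,\alpha_d$, and suppose $\{G_n\}$ exhibits exponential growth. Then there is a constant $\gamma>0$ (depending only on the sequence) such that for every $n>1$ and every $\epsilon\in(0,1/2)$ the mixing time of the random walk on $\mathbb{Z}_{G_n}$ determined by the sequence satisfies $$t_{mix}(\epsilon)\ge\frac{n-\gamma\log n}{\gamma\log n}\,\log\left(\frac{1}{2\epsilon}\right).$$
   Context: The coefficients $\alpha_1,\dots,\alpha_d$ ($d\ge 1$) are real constants. The sequence $\{G_n\}$ exhibits exponential growth if there exists $\kappa_2>0$ such that $\kappa_2 n\le\log G_n$ for all sufficiently large $n$. For fixed $n$, the random walk determined by $\{G_n\}_{n\ge1}$ is the Markov chain $(X_t)_{t\ge 0}$ on $\mathbb{Z}_{G_n}=\mathbb{Z}/G_n\mathbb{Z}$ with $X_0=0$ and $X_{t+1}\equiv X_t+z_t \pmod{G_n}$, where the $z_t$ are independent and each $z_t$ is uniform on $\{G_1,G_2,\dots,G_n\}$. Let $P_0^t$ be the distribution of $X_t$ and $\pi$ the uniform distribution on $\mathbb{Z}_{G_n}$. The total variation distance between probability distributions on a finite set $S$ is $\|\mu-\eta\|_{TV}=\frac12\sum_{x\in S}|\mu(x)-\eta(x)|$. The mixing time is $t_{mix}(\epsilon)=\min\{t\in\mathbb{Z}_{\ge 0}:\|P_0^t-\pi\|_{TV}\le\epsilon\}$.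 Here $\log$ is the natural logarithm. *)

theory Defs
  imports "HOL-Probability.Probability"
begin

text \<open>
  Sequences indexed by the positive integers are functions on \<^typ>\<open>nat\<close> whose value at 0 is
  irrelevant: none of the definitions below reads \<open>G 0\<close> when \<open>n \<ge> 1\<close>.
\<close>

definition linear_recurrence :: "nat \<Rightarrow> (nat \<Rightarrow> real) \<Rightarrow> (nat \<Rightarrow> nat) \<Rightarrow> bool" where
  "linear_recurrence d \<alpha> G \<longleftrightarrow> (\<forall>n>d. real (G n) = (\<Sum>i=1..d. \<alpha> i * real (G (n - i))))"

definition exponential_growth :: "(nat \<Rightarrow> nat) \<Rightarrow> bool" where
  "exponential_growth G \<longleftrightarrow>
     (\<exists>\<kappa>>0. \<forall>\<^sub>F n in sequentially. \<kappa> * real n \<le> ln (real (G n)))"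

text \<open>
  The group of integers modulo \<open>G n\<close> is represented by its residues \<open>{..<G n}\<close>.
  \<open>walk_dist G n t\<close> is the law of \<open>X\<^sub>t\<close>; drawing \<open>z\<close> inside the bind makes each
  increment independent of the past.
\<close>

primrec walk_dist :: "(nat \<Rightarrow> nat) \<Rightarrow> nat \<Rightarrow> nat \<Rightarrow> nat pmf" where
  "walk_dist G n 0 = return_pmf 0"
| "walk_dist G n (Suc t) =
     bind_pmf (walk_dist G n t) (\<lambda>x.
     bind_pmf (pmf_of_set (G ` {1..n})) (\<lambda>z.
     return_pmf ((x + z) mod G n)))"

definition tv_dist :: "'a set \<Rightarrow> 'a pmf \<Rightarrow> 'a pmf \<Rightarrow> real" where
  "tv_dist S \<mu> \<eta> = 1 / 2 * (\<Sum>x\<in>S. \<bar>pmf \<mu> x - pmf \<eta> x\<bar>)"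

text \<open>
  The minimum below is attained for every \<open>\<epsilon> > 0\<close> when \<open>G\<close> is positive and \<open>G 1 = 1\<close>:
  the increment \<open>G 1 = 1\<close> makes the chain irreducible, and \<open>G n\<close>, which is 0 modulo \<open>G n\<close>,
  makes it aperiodic.
\<close>

definition mixing_time :: "(nat \<Rightarrow> nat) \<Rightarrow> nat \<Rightarrow> real \<Rightarrow> nat" where
  "mixing_time G n \<epsilon> =
     (LEAST t. tv_dist {..<G n} (walk_dist G n t) (pmf_of_set {..<G n}) \<le> \<epsilon>)"

end

theory Submission
  imports Defs "HOL-Real_Asymp.Real_Asymp"
begin

text \<open>
  The bound comes from a single slow mode. Let \<open>N = G n\<close> and \<open>w = cis (2 * pi / N)\<close>. The character
  \<open>x \<mapsto> w ^ x\<close> is an eigenfunction of the walk; its eigenvalue \<open>b\<close> is the average of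
  \<open>cis (2 * pi * G k / G n)\<close> over \<open>k = 1, \<dots>, n\<close>. It has mean \<open>b ^ t\<close> under the law at time \<open>t\<close> and mean 0
  under the uniform distribution, so the distance to uniformity at time \<open>t\<close> is at least
  \<open>\<bar>b\<bar> ^ t / 2\<close> (\<open>step_eigenvalue_power_le_tv_dist\<close>). It remains to see that \<open>b\<close> is close to 1.

  Most of the numbers \<open>G k / G n\<close> are tiny: \<open>G 1 + \<dots> + G n \<le> K * G n\<close> with \<open>K\<close> independent of \<open>n\<close>
  (\<open>sum_le_const_mult_last\<close>), which gives \<open>\<bar>b\<bar> \<ge> 1 - 2 * pi * K / n\<close>. For a characteristic
  polynomial \<open>p\<close> with \<open>p(1) \<noteq> 0\<close> this inequality follows by adding up the recurrence: that expresses
  \<open>p(1)\<close> times the partial sum through a bounded number of boundary terms, and those are at most a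
  constant times the last value since \<open>G\<close> is increasing. If \<open>p = (x - 1)^m q\<close> with \<open>q(1) \<noteq> 0\<close>, the
  sequence satisfies the recurrence of \<open>q\<close> up to a polynomially bounded error; the partial sums of
  this error are again polynomially bounded, and exponential growth makes them negligible against
  \<open>G n\<close>.

  Hence, with \<open>C = 2 * pi * K\<close>, the mixing time is at least \<open>(n / C - 1) * ln (1 / (2 * \<epsilon>))\<close> for
  \<open>n > C\<close>. Replacing \<open>C\<close> by something larger weakens this bound, and \<open>\<gamma> = C / ln 2\<close> ensures
  \<open>\<gamma> * ln n \<ge> C\<close> for all \<open>n > 1\<close>. For \<open>n \<le> C\<close> the claimed lower bound is at most 0.

  The distance at the mixing time is at most \<open>\<epsilon>\<close> only if some time achieves this, that is, because
  the walk converges to the uniform distribution (\<open>walk_dist_tendsto_uniform\<close>): every nontrivial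
  eigenvalue has norm below 1, as both 0 and 1 occur among the increments modulo \<open>N\<close>.
\<close>

section \<open>Partial sums of exponentially growing linear recurrences\<close>

text \<open>
  With \<open>E\<close> the shift operator on sequences, this is \<open>p(E) f\<close>. A sequence satisfies a linear
  recurrence with constant coefficients exactly when some \<open>p(E)\<close> with \<open>p \<noteq> 0\<close> kills it.
\<close>

definition shift_act :: "real poly \<Rightarrow> (nat \<Rightarrow> real) \<Rightarrow> nat \<Rightarrow> real" where
  "shift_act p f n = (\<Sum>i\<le>degree p. coeff p i * f (n + i))"

lemma shift_act_eq_sum:
  assumes "degree p \<le> m"
  shows "shift_act p f n = (\<Sum>i\<le>m. coeff p i * f (n + i))"
  unfolding shift_act_def using assms
  by (intro sum.mono_neutral_left) (auto simp: coeff_eq_0)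

text \<open>
  As \<open>p \<mapsto> p(E)\<close> is multiplicative and \<open>E - 1\<close> is the difference operator, a root of \<open>p\<close> at 1
  can be removed at the price of one summation.
\<close>

lemma shift_act_linear_factor:
  "shift_act ([:-1, 1:] * q) f n = shift_act q f (Suc n) - shift_act q f n"
proof -
  let ?m = "degree q"
  have deg: "degree ([:-1, 1:] * q) \<le> Suc ?m"
    using degree_mult_le[of "[:-1, 1:]" q] by simp
  have cf: "[:-1, 1:] * q = pCons 0 q - q"
    by (simp add: algebra_simps)
  have "shift_act ([:-1, 1:] * q) f n
      = (\<Sum>i\<le>Suc ?m. coeff (pCons 0 q) i * f (n + i)) - (\<Sum>i\<le>Suc ?m. coeff q i * f (n + i))"
    by (subst shift_act_eq_sum[OF deg]) (simp only: cf coeff_diff left_diff_distrib sum_subtractf)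
  also have "(\<Sum>i\<le>Suc ?m. coeff (pCons 0 q) i * f (n + i)) = shift_act q f (Suc n)"
    unfolding shift_act_def by (subst sum.atMost_Suc_shift) simp
  also have "(\<Sum>i\<le>Suc ?m. coeff q i * f (n + i)) = shift_act q f n"
    by (rule shift_act_eq_sum[symmetric]) simp
  finally show ?thesis .
qed

lemma bound_of_difference_bound:
  fixes h :: "nat \<Rightarrow> real"
  assumes "\<And>n. \<bar>h (Suc n) - h n\<bar> \<le> C * (real n + 1) ^ j"
  shows "\<exists>D. \<forall>n. \<bar>h n\<bar> \<le> D * (real n + 1) ^ Suc j"
proof -
  define D where "D = \<bar>h 0\<bar> + \<bar>C\<bar>"
  have "\<bar>h n\<bar> \<le> D * (real n + 1) ^ Suc j" for n
  proof (induction n)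
    case 0
    then show ?case by (simp add: D_def)
  next
    case (Suc n)
    have "C * (real n + 1) ^ j \<le> \<bar>C\<bar> * (real n + 1) ^ j"
      by (intro mult_right_mono) auto
    then have "\<bar>h (Suc n)\<bar> \<le> \<bar>h n\<bar> + \<bar>C\<bar> * (real n + 1) ^ j"
      using assms[of n] by linarith
    also have "\<dots> \<le> D * (real n + 1) ^ Suc j + D * (real n + 1) ^ j"
      by (intro add_mono Suc mult_right_mono) (auto simp: D_def)
    also have "\<dots> = D * ((real n + 2) * (real n + 1) ^ j)"
      by (simp add: algebra_simps)
    also have "\<dots> \<le> D * ((real n + 2) * (real n + 2) ^ j)"
      by (intro mult_left_mono power_mono) (auto simp: D_def)
    finally show ?case by (simp add: add_ac)
  qed
  then show ?thesis by blast
qed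

text \<open>
  The two sums differ by at most \<open>i\<close> terms at either end, and each of those is at most
  \<open>f (N + d)\<close>.
\<close>

lemma partial_sums_shift_bound:
  fixes f :: "nat \<Rightarrow> real"
  assumes "mono f" "\<And>n. f n \<ge> 0" "i \<le> d"
  shows "\<bar>(\<Sum>n<N. f (n + i)) - (\<Sum>n<N. f n)\<bar> \<le> 2 * real d * f (N + d)"
proof -
  have "(\<Sum>n<N. f (n + i)) + (\<Sum>n<i. f n) = (\<Sum>n<N. f n) + (\<Sum>n<i. f (n + N))"
  proof -
    have "(\<Sum>n<i. f n) + (\<Sum>n<N. f (n + i)) = (\<Sum>n<N + i. f n)" for N i
      using sum.atLeastLessThan_concat[of 0 i "N + i" f] sum.shift_bounds_nat_ivl[of f 0 i N]
      by (simp add: atLeast0LessThan)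
    from this[of i N] this[of N i] show ?thesis by (simp add: add_ac)
  qed
  moreover have "(\<Sum>n<i. f (n + N)) \<le> real i * f (N + d)"
    using sum_bounded_above[of "{..<i}" "\<lambda>n. f (n + N)" "f (N + d)"] assms(3)
    by (simp add: monoD[OF \<open>mono f\<close>])
  moreover have "(\<Sum>n<i. f n) \<le> real i * f (N + d)"
    using sum_bounded_above[of "{..<i}" f "f (N + d)"] assms(3)
    by (simp add: monoD[OF \<open>mono f\<close>])
  moreover have "(\<Sum>n<i. f (n + N)) \<ge> 0" "(\<Sum>n<i. f n) \<ge> 0"
    using assms by (auto intro!: sum_nonneg)
  moreover have "real i * f (N + d) \<le> real d * f (N + d)"
    using assms by (intro mult_right_mono) auto
  ultimately show ?thesis by linarith
qed

text \<open>
  Sum \<open>p(E) f\<close> over \<open>n < N\<close> and replace each shifted sum \<open>\<Sum>n<N. f (n + i)\<close> by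
  \<open>S N = (\<Sum>n<N. f n)\<close>. The coefficients add up to \<open>p(1)\<close>, so \<open>p(1) * S N\<close> equals the sum of
  \<open>p(E) f\<close>, which is polynomially bounded and hence \<open>O(f)\<close> by the growth hypothesis, up to
  boundary terms, which are also \<open>O(f (N + d))\<close>. Since \<open>p(1) \<noteq> 0\<close>, this bounds \<open>S N\<close>, and the last
  \<open>d + 1\<close> summands of a partial sum are each at most its last term.
\<close>

lemma partial_sums_bound_of_nonzero_at_1:
  fixes f :: "nat \<Rightarrow> real"
  assumes f: "mono f" "\<And>n. f n \<ge> 0"
    and growth: "\<And>j. \<exists>B. \<forall>n. (real n + 1) ^ j \<le> B * f n"
    and p: "poly p 1 \<noteq> 0"
    and bound: "\<And>n. \<bar>shift_act p f n\<bar> \<le> C * (real n + 1) ^ j"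
  shows "\<exists>K. \<forall>N. (\<Sum>k\<le>N. f k) \<le> K * f N"
proof -
  define d where "d = degree p"
  define S where "S N = (\<Sum>n<N. f n)" for N
  define A where "A = (\<Sum>i\<le>d. \<bar>coeff p i\<bar> * (2 * real d))"
  obtain B where B: "\<And>n. (real n + 1) ^ Suc j \<le> B * f n"
    using growth[of "Suc j"] by blast
  define E where "E = (A + \<bar>C\<bar> * B) / \<bar>poly p 1\<bar>"
  have main: "S N \<le> E * f (N + d)" for N
  proof -
    have "(\<Sum>n<N. shift_act p f n) = (\<Sum>i\<le>d. coeff p i * (\<Sum>n<N. f (n + i)))"
      unfolding shift_act_def d_def[symmetric] sum_distrib_left by (rule sum.swap)
    also have "\<dots> = (\<Sum>i\<le>d. coeff p i * S N) + (\<Sum>i\<le>d. coeff p i * ((\<Sum>n<N. f (n + i)) - S N))"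
      by (simp add: sum.distrib[symmetric] algebra_simps)
    also have "(\<Sum>i\<le>d. coeff p i * S N) = poly p 1 * S N"
      by (simp add: poly_altdef d_def sum_distrib_right)
    finally have "poly p 1 * S N
        = (\<Sum>n<N. shift_act p f n) - (\<Sum>i\<le>d. coeff p i * ((\<Sum>n<N. f (n + i)) - S N))"
      by simp
    then have "\<bar>poly p 1\<bar> * S N
        = \<bar>(\<Sum>n<N. shift_act p f n) - (\<Sum>i\<le>d. coeff p i * ((\<Sum>n<N. f (n + i)) - S N))\<bar>"
      using f(2) by (metis S_def abs_mult abs_of_nonneg sum_nonneg)
    also have "\<dots> \<le> \<bar>\<Sum>n<N. shift_act p f n\<bar> + \<bar>\<Sum>i\<le>d. coeff p i * ((\<Sum>n<N. f (n + i)) - S N)\<bar>"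
      by (rule abs_triangle_ineq4)
    also have "\<bar>\<Sum>i\<le>d. coeff p i * ((\<Sum>n<N. f (n + i)) - S N)\<bar> \<le> A * f (N + d)"
    proof -
      have "\<bar>\<Sum>i\<le>d. coeff p i * ((\<Sum>n<N. f (n + i)) - S N)\<bar>
          \<le> (\<Sum>i\<le>d. \<bar>coeff p i * ((\<Sum>n<N. f (n + i)) - S N)\<bar>)"
        by (rule sum_abs)
      also have "\<dots> \<le> (\<Sum>i\<le>d. \<bar>coeff p i\<bar> * (2 * real d * f (N + d)))"
        unfolding abs_mult S_def
        by (intro sum_mono mult_left_mono partial_sums_shift_bound f) auto
      finally show ?thesis by (simp add: A_def sum_distrib_right mult.assoc)
    qed
    also have "\<bar>\<Sum>n<N. shift_act p f n\<bar> \<le> \<bar>C\<bar> * B * f (N + d)"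
    proof -
      have "\<bar>\<Sum>n<N. shift_act p f n\<bar> \<le> (\<Sum>n<N. \<bar>C\<bar> * (real (N + d) + 1) ^ j)"
      proof (rule order_trans[OF sum_abs], rule sum_mono)
        fix n assume "n \<in> {..<N}"
        have "C * (real n + 1) ^ j \<le> \<bar>C\<bar> * (real n + 1) ^ j"
          by (intro mult_right_mono) auto
        then have "\<bar>shift_act p f n\<bar> \<le> \<bar>C\<bar> * (real n + 1) ^ j"
          using bound[of n] by linarith
        also have "\<dots> \<le> \<bar>C\<bar> * (real (N + d) + 1) ^ j"
          using \<open>n \<in> {..<N}\<close> by (intro mult_left_mono power_mono) auto
        finally show "\<bar>shift_act p f n\<bar> \<le> \<bar>C\<bar> * (real (N + d) + 1) ^ j" .
      qed
      also have "\<dots> = \<bar>C\<bar> * (real N * (real (N + d) + 1) ^ j)" by simp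
      also have "\<dots> \<le> \<bar>C\<bar> * ((real (N + d) + 1) * (real (N + d) + 1) ^ j)"
        by (intro mult_left_mono mult_right_mono) auto
      also have "\<dots> \<le> \<bar>C\<bar> * (B * f (N + d))"
        using B[of "N + d"] by (intro mult_left_mono) simp_all
      finally show ?thesis by (simp add: mult.assoc)
    qed
    finally show ?thesis
      using p by (simp add: E_def divide_simps algebra_simps)
  qed
  have "(\<Sum>k\<le>N. f k) \<le> (\<bar>E\<bar> + real d + 1) * f N" for N
  proof -
    have mN: "f k \<le> f N" if "k \<le> N" for k using that f(1) by (simp add: monoD)
    show ?thesis
    proof (cases "d \<le> N")
      case True
      have "{..N} = {..<N - d} \<union> {N - d..N}" by auto
      then have "(\<Sum>k\<le>N. f k) = S (N - d) + (\<Sum>k\<in>{N - d..N}. f k)"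
        unfolding S_def by (simp add: sum.union_disjoint ivl_disj_int)
      also have "S (N - d) \<le> E * f N" using main[of "N - d"] True by simp
      also have "E * f N \<le> \<bar>E\<bar> * f N" by (intro mult_right_mono f) auto
      also have "(\<Sum>k\<in>{N - d..N}. f k) \<le> real (card {N - d..N}) * f N"
        by (intro sum_bounded_above mN) auto
      also have "real (card {N - d..N}) = real d + 1" using True by simp
      finally show ?thesis by (simp add: algebra_simps)
    next
      case False
      have "(\<Sum>k\<le>N. f k) \<le> real (card {..N}) * f N"
        by (intro sum_bounded_above mN) auto
      also have "\<dots> \<le> (\<bar>E\<bar> + real d + 1) * f N"
        using False by (intro mult_right_mono f) auto
      finally show ?thesis .
    qed
  qed
  then show ?thesis by blast
qed

text \<open>
  If \<open>p(1) = 0\<close>, then \<open>p = (x - 1) q\<close>, so the differences of \<open>q(E) f\<close> are polynomially bounded,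
  and so is \<open>q(E) f\<close> itself, with an exponent one higher. Allowing a polynomial error in the
  recurrence instead of requiring \<open>p(E) f = 0\<close> is what makes this descent on the degree possible;
  it stops at a factor that does not vanish at 1.
\<close>

lemma partial_sums_bound:
  fixes f :: "nat \<Rightarrow> real"
  assumes f: "mono f" "\<And>n. f n \<ge> 0"
    and growth: "\<And>j. \<exists>B. \<forall>n. (real n + 1) ^ j \<le> B * f n"
    and "p \<noteq> 0"
    and "\<And>n. \<bar>shift_act p f n\<bar> \<le> C * (real n + 1) ^ j"
  shows "\<exists>K. \<forall>N. (\<Sum>k\<le>N. f k) \<le> K * f N"
  using assms(4,5)
proof (induction "degree p" arbitrary: p C j rule: less_induct)
  case less
  show ?case
  proof (cases "poly p 1 = 0")
    case False
    then show ?thesis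
      using partial_sums_bound_of_nonzero_at_1[OF f growth] less.prems by blast
  next
    case True
    then obtain q where q: "p = [:-1, 1:] * q"
      by (auto simp: poly_eq_0_iff_dvd dvd_def)
    have "q \<noteq> 0" using q less.prems by auto
    then have "degree p = Suc (degree q)"
      unfolding q by (subst degree_mult_eq) auto
    moreover have "\<bar>shift_act q f (Suc n) - shift_act q f n\<bar> \<le> C * (real n + 1) ^ j" for n
      using less.prems(2)[of n] by (simp only: q shift_act_linear_factor)
    then obtain D where "\<And>n. \<bar>shift_act q f n\<bar> \<le> D * (real n + 1) ^ Suc j"
      using bound_of_difference_bound by blast
    ultimately show ?thesis using less.hyps[of q D "Suc j"] \<open>q \<noteq> 0\<close> by simp
  qed
qed

lemma powers_bounded_of_exponential_growth:
  assumes pos: "\<And>n. n \<ge> 1 \<Longrightarrow> G n > 0" and "exponential_growth G"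
  shows "\<exists>B. \<forall>n. (real n + 1) ^ j \<le> B * real (G (Suc n))"
proof -
  obtain \<kappa> where \<kappa>: "\<kappa> > 0" and ev: "\<forall>\<^sub>F n in sequentially. \<kappa> * real n \<le> ln (real (G n))"
    using assms(2) unfolding exponential_growth_def by blast
  have "\<forall>\<^sub>F n::nat in sequentially. (real n + 1) ^ j \<le> exp (\<kappa> * real (Suc n))"
    using \<kappa> by real_asymp
  moreover have "\<forall>\<^sub>F n in sequentially. \<kappa> * real (Suc n) \<le> ln (real (G (Suc n)))"
    using ev eventually_sequentially_Suc[of "\<lambda>n. \<kappa> * real n \<le> ln (real (G n))"] by blast
  ultimately have "\<forall>\<^sub>F n in sequentially. (real n + 1) ^ j \<le> real (G (Suc n))"
  proof eventually_elim
    case (elim n)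
    have "exp (\<kappa> * real (Suc n)) \<le> exp (ln (real (G (Suc n))))" using elim by simp
    also have "\<dots> = real (G (Suc n))" using pos[of "Suc n"] by simp
    finally show ?case using elim by linarith
  qed
  then obtain M where M: "\<And>n. n \<ge> M \<Longrightarrow> (real n + 1) ^ j \<le> real (G (Suc n))"
    by (auto simp: eventually_sequentially)
  have "(real n + 1) ^ j \<le> (real M + 1) ^ j * real (G (Suc n))" for n
  proof (cases "n \<ge> M")
    case True
    have "1 * real (G (Suc n)) \<le> (real M + 1) ^ j * real (G (Suc n))"
      by (intro mult_right_mono one_le_power) auto
    then show ?thesis using M[OF True] by linarith
  next
    case False
    have "(real n + 1) ^ j \<le> (real M + 1) ^ j * 1"
      using False by (simp add: power_mono)
    also have "\<dots> \<le> (real M + 1) ^ j * real (G (Suc n))"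
      using pos[of "Suc n"] by (intro mult_left_mono) auto
    finally show ?thesis .
  qed
  then show ?thesis by blast
qed

lemma linear_recurrence_annihilator:
  assumes "linear_recurrence d \<alpha> G"
  shows "\<exists>p. p \<noteq> 0 \<and> (\<forall>n. shift_act p (\<lambda>n. real (G (Suc n))) n = 0)"
proof -
  \<comment> \<open>the characteristic polynomial \<open>x^d - \<alpha> 1 * x^(d-1) - \<dots> - \<alpha> d\<close>\<close>
  define p where "p = Poly (map (\<lambda>i. if i = d then 1 else - \<alpha> (d - i)) [0..<Suc d])"
  have coeff_p: "coeff p i = (if i = d then 1 else - \<alpha> (d - i))" if "i \<le> d" for i
    using that by (simp add: p_def nth_default_def del: upt_Suc)
  have "degree p \<le> d"
    by (rule degree_le) (auto simp: p_def nth_default_def simp del: upt_Suc)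
  have "shift_act p (\<lambda>n. real (G (Suc n))) n = 0" for n
  proof -
    have "shift_act p (\<lambda>n. real (G (Suc n))) n
        = (\<Sum>i\<le>d. (if i = d then 1 else - \<alpha> (d - i)) * real (G (Suc (n + i))))"
      unfolding shift_act_eq_sum[OF \<open>degree p \<le> d\<close>] by (intro sum.cong) (auto simp: coeff_p)
    also have "{..d} = insert d {..<d}" by auto
    also have "(\<Sum>i\<in>insert d {..<d}. (if i = d then 1 else - \<alpha> (d - i)) * real (G (Suc (n + i))))
        = real (G (Suc (n + d))) - (\<Sum>i<d. \<alpha> (d - i) * real (G (Suc (n + i))))"
      by (simp add: sum_negf)
    also have "(\<Sum>i<d. \<alpha> (d - i) * real (G (Suc (n + i))))
        = (\<Sum>i=1..d. \<alpha> i * real (G (Suc (n + d) - i)))"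
      by (rule sum.reindex_bij_witness[of _ "\<lambda>i. d - i" "\<lambda>i. d - i"]) auto
    also have "real (G (Suc (n + d))) = \<dots>"
      using assms by (simp add: linear_recurrence_def)
    finally show ?thesis by simp
  qed
  moreover have "p \<noteq> 0" using coeff_p[of d] by auto
  ultimately show ?thesis by blast
qed

text \<open>
  As for a geometric sequence, the last few terms dominate each partial sum: the number of ratios
  \<open>G k / G n\<close> that exceed a given positive number is bounded independently of \<open>n\<close>.
\<close>

lemma sum_le_const_mult_last:
  assumes "\<And>n. n \<ge> 1 \<Longrightarrow> G n > 0" "strict_mono_on {1..} G"
    and "linear_recurrence d \<alpha> G" "exponential_growth G"
  shows "\<exists>K>0. \<forall>n\<ge>1. (\<Sum>k=1..n. real (G k)) \<le> K * real (G n)"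
proof -
  let ?f = "\<lambda>n. real (G (Suc n))"
  obtain p where p: "p \<noteq> 0" "\<And>n. shift_act p ?f n = 0"
    using linear_recurrence_annihilator[OF assms(3)] by blast
  have "mono ?f"
    using assms(2) by (intro monoI) (simp add: strict_mono_on_leD)
  then obtain K where K: "\<And>N. (\<Sum>k\<le>N. ?f k) \<le> K * ?f N"
    using partial_sums_bound[of ?f p 0 0] p powers_bounded_of_exponential_growth[OF assms(1,4)]
    by auto
  have "(\<Sum>k=1..n. real (G k)) \<le> (\<bar>K\<bar> + 1) * real (G n)" if n: "n \<ge> 1" for n
  proof -
    have "(\<Sum>k=1..n. real (G k)) = (\<Sum>k\<le>n - 1. ?f k)"
      using n by (intro sum.reindex_bij_witness[of _ Suc "\<lambda>k. k - 1"]) auto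
    also have "\<dots> \<le> K * real (G n)" using K[of "n - 1"] n by simp
    also have "\<dots> \<le> (\<bar>K\<bar> + 1) * real (G n)" by (intro mult_right_mono) auto
    finally show ?thesis .
  qed
  then show ?thesis by (intro exI[of _ "\<bar>K\<bar> + 1"]) auto
qed

section \<open>Characters and the law of the walk\<close>

abbreviation step_set :: "(nat \<Rightarrow> nat) \<Rightarrow> nat \<Rightarrow> nat set" where
  "step_set G n \<equiv> G ` {1..n}"

text \<open>
  For \<open>w\<close> with \<open>w ^ G n = 1\<close>, the character \<open>x \<mapsto> w ^ x\<close> of the group of residues is an eigenfunction
  of the transition operator, and this average is its eigenvalue.
\<close>

definition step_eigenvalue :: "(nat \<Rightarrow> nat) \<Rightarrow> nat \<Rightarrow> complex \<Rightarrow> complex" where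
  "step_eigenvalue G n w = (\<Sum>z\<in>step_set G n. w ^ z) / of_nat (card (step_set G n))"

lemma root_of_unity_power_mod:
  fixes w :: complex
  assumes "w ^ N = 1"
  shows "w ^ (x mod N) = w ^ x"
proof -
  have "w ^ x = w ^ (N * (x div N) + x mod N)" by simp
  also have "\<dots> = w ^ (x mod N)" unfolding power_add power_mult assms by simp
  finally show ?thesis by simp
qed

lemma set_walk_dist:
  assumes "n \<ge> 1" "G n > 0"
  shows "set_pmf (walk_dist G n t) \<subseteq> {..<G n}"
  using assms by (induction t) auto

text \<open>
  The increments are independent and characters are multiplicative, so each step contributes one
  factor to the Fourier transform of the law.
\<close>

lemma walk_dist_character:
  assumes "n \<ge> 1" "G n > 0" and w: "w ^ G n = 1"
  shows "(\<Sum>x<G n. complex_of_real (pmf (walk_dist G n t) x) * w ^ x) = step_eigenvalue G n w ^ t"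
proof -
  have E: "(\<Sum>x<G n. complex_of_real (pmf (walk_dist G n t) x) * w ^ x)
      = measure_pmf.expectation (walk_dist G n t) (\<lambda>x. w ^ x)" for t
    using set_walk_dist[of n G t, OF assms(1,2)]
    by (subst integral_measure_pmf[of "{..<G n}"]) (auto simp: scaleR_conv_of_real)
  have "measure_pmf.expectation (walk_dist G n t) (\<lambda>x. w ^ x) = step_eigenvalue G n w ^ t"
  proof (induction t)
    case 0
    then show ?case by simp
  next
    case (Suc t)
    have step: "measure_pmf.expectation
          (bind_pmf (pmf_of_set (step_set G n)) (\<lambda>z. return_pmf ((x + z) mod G n))) (\<lambda>x. w ^ x)
        = w ^ x * step_eigenvalue G n w" for x
      using \<open>n \<ge> 1\<close>
      by (subst pmf_expectation_bind_pmf_of_set)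
         (auto simp: root_of_unity_power_mod[OF w] power_add step_eigenvalue_def
            sum_distrib_left scaleR_conv_of_real sum_divide_distrib field_simps)
    have "measure_pmf.expectation (walk_dist G n (Suc t)) (\<lambda>x. w ^ x)
        = (\<Sum>x<G n. pmf (walk_dist G n t) x *\<^sub>R (w ^ x * step_eigenvalue G n w))"
      unfolding walk_dist.simps
      using set_walk_dist[of n G t, OF assms(1,2)] \<open>n \<ge> 1\<close>
      by (subst pmf_expectation_bind[of "{..<G n}"]) (auto simp: step simp del: One_nat_def)
    also have "\<dots> = (\<Sum>x<G n. complex_of_real (pmf (walk_dist G n t) x) * w ^ x)
        * step_eigenvalue G n w"
      by (simp add: sum_distrib_right scaleR_conv_of_real mult.assoc)
    also have "\<dots> = step_eigenvalue G n w ^ Suc t"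
      unfolding E Suc.IH by simp
    finally show ?case .
  qed
  then show ?thesis by (simp add: E)
qed

section \<open>Convergence to the uniform distribution\<close>

text \<open>
  The increments \<open>1\<close> and \<open>G n\<close> contribute \<open>w + 1\<close>, whose norm is strictly below 2 because
  the unit vectors \<open>w\<close> and \<open>1\<close> are different; every other increment contributes at most 1.
\<close>

lemma norm_step_eigenvalue_less_1:
  assumes "n \<ge> 1" "G 1 = 1" "G n > 1" and w: "w ^ G n = 1" "w \<noteq> 1"
  shows "norm (step_eigenvalue G n w) < 1"
proof -
  let ?A = "step_set G n"
  have nw: "norm w = 1"
    using power_eq_1_iff[OF w(1)] \<open>G n > 1\<close> by simp
  have A: "finite ?A" "1 \<in> ?A" "G n \<in> ?A"
    using assms imageI[of 1 "{1..n}" G] by auto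
  \<comment> \<open>the parallelogram law for two unit vectors\<close>
  have "(norm (w + 1))\<^sup>2 + (norm (w - 1))\<^sup>2 = 4"
  proof -
    have "(Re w)\<^sup>2 + (Im w)\<^sup>2 = 1" using nw cmod_power2[of w] by simp
    then show ?thesis unfolding cmod_power2 by (simp add: power2_eq_square algebra_simps)
  qed
  moreover have "(norm (w - 1))\<^sup>2 > 0" using w(2) by simp
  ultimately have "(norm (w + 1))\<^sup>2 < 4" by linarith
  then have "(norm (w + 1))\<^sup>2 < 2\<^sup>2" by simp
  then have two: "norm (w + 1) < 2"
    by (rule power2_less_imp_less) simp
  have "(\<Sum>z\<in>?A. w ^ z) = (\<Sum>z\<in>{1, G n}. w ^ z) + (\<Sum>z\<in>?A - {1, G n}. w ^ z)"
    using A by (subst sum.subset_diff[of "{1, G n}"]) (auto simp: add.commute)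
  then have "(\<Sum>z\<in>?A. w ^ z) = (w + 1) + (\<Sum>z\<in>?A - {1, G n}. w ^ z)"
    using \<open>G n > 1\<close> w(1) by simp
  then have "norm (\<Sum>z\<in>?A. w ^ z) \<le> norm (w + 1) + norm (\<Sum>z\<in>?A - {1, G n}. w ^ z)"
    using norm_triangle_ineq by metis
  also have "norm (\<Sum>z\<in>?A - {1, G n}. w ^ z) \<le> real (card (?A - {1, G n}))"
    using sum_norm_bound[of "?A - {1, G n}" "\<lambda>z. w ^ z" 1] nw by (simp add: norm_power)
  also have "card (?A - {1, G n}) = card ?A - 2"
    using A \<open>G n > 1\<close> by (subst card_Diff_subset) auto
  also have "norm (w + 1) + real (card ?A - 2) < real (card ?A)"
  proof -
    have "card {1, G n} \<le> card ?A" using A by (intro card_mono) auto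
    then show ?thesis using two \<open>G n > 1\<close> by simp
  qed
  finally have "norm (\<Sum>z\<in>?A. w ^ z) < real (card ?A)" by simp
  then show ?thesis
    by (simp add: step_eigenvalue_def norm_divide divide_less_eq)
qed

lemma cis_root_power_eq_1_iff:
  assumes "N > 0"
  shows "cis (2 * pi / real N) ^ k = 1 \<longleftrightarrow> N dvd k"
  using complex_root_unity_eq_1[of N k] assms
  by (subst Complex.DeMoivre) (simp add: cis_conv_exp mult_ac)

text \<open>
  The exponent \<open>N - y\<close> stands for \<open>- y\<close>, as \<open>z\<close> is an \<open>N\<close>-th root of unity.
\<close>

lemma fourier_inversion:
  assumes "y < N"
  defines "z \<equiv> cis (2 * pi / real N)"
  shows "complex_of_real (g y)
    = (\<Sum>s<N. (\<Sum>x<N. complex_of_real (g x) * (z ^ s) ^ x) * (z ^ s) ^ (N - y)) / of_nat N"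
proof -
  have N: "N > 0" using assms by simp
  have z1: "z ^ k = 1 \<longleftrightarrow> N dvd k" for k
    unfolding z_def by (rule cis_root_power_eq_1_iff[OF N])
  have orth: "(\<Sum>s<N. (z ^ (x + (N - y))) ^ s) = (if x = y then of_nat N else 0)" if "x < N" for x
  proof -
    have "N dvd x + (N - y) \<longleftrightarrow> x = y"
    proof
      assume "N dvd x + (N - y)"
      then obtain c where c: "x + (N - y) = N * c" by blast
      have "0 < c" using c \<open>y < N\<close> by (cases c) auto
      moreover have "N * c < N * 2" using c that \<open>y < N\<close> by linarith
      then have "c < 2" by simp
      ultimately have "c = 1" by simp
      then show "x = y" using c \<open>y < N\<close> by simp
    qed (use \<open>y < N\<close> in simp)
    then have "z ^ (x + (N - y)) = 1 \<longleftrightarrow> x = y"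
      by (simp only: z1)
    moreover have "(z ^ (x + (N - y))) ^ N = 1"
      using z1[of "(x + (N - y)) * N"] by (simp only: power_mult dvd_triv_right)
    ultimately show ?thesis
      by (simp only: sum_gp_strict diff_self div_0)
  qed
  have "(z ^ s) ^ x * (z ^ s) ^ (N - y) = (z ^ (x + (N - y))) ^ s" for s x
    by (metis distrib_right mult.commute power_add power_mult)
  then have "(\<Sum>s<N. (\<Sum>x<N. complex_of_real (g x) * (z ^ s) ^ x) * (z ^ s) ^ (N - y))
      = (\<Sum>x<N. complex_of_real (g x) * (\<Sum>s<N. (z ^ (x + (N - y))) ^ s))"
    unfolding sum_distrib_right sum_distrib_left
    by (subst sum.swap) (simp only: mult.assoc)
  also have "\<dots> = (\<Sum>x<N. if x = y then complex_of_real (g x) * of_nat N else 0)"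
    by (intro sum.cong) (auto simp: orth)
  also have "\<dots> = complex_of_real (g y) * of_nat N"
    using \<open>y < N\<close> by (simp add: sum.delta)
  finally show ?thesis using N by simp
qed

text \<open>
  In the Fourier expansion of the law, the trivial character contributes \<open>1 / G n\<close> at all times,
  and the others decay geometrically.
\<close>

lemma walk_dist_tendsto_uniform:
  assumes "n \<ge> 1" "G 1 = 1" "G n > 1" and y: "y < G n"
  shows "(\<lambda>t. pmf (walk_dist G n t) y) \<longlonglongrightarrow> 1 / real (G n)"
proof -
  define N where "N = G n"
  define z where "z = cis (2 * pi / real N)"
  have N: "N > 1" using assms by (simp add: N_def)
  have zN: "(z ^ s) ^ N = 1" for s
  proof -
    have "z ^ N = 1" using N by (simp add: z_def Complex.DeMoivre)
    then show ?thesis by (metis mult.commute power_mult power_one)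
  qed
  have z1: "z ^ s \<noteq> 1" if "0 < s" "s < N" for s
    using that N by (auto simp: z_def cis_root_power_eq_1_iff dest: dvd_imp_le)
  have "complex_of_real (pmf (walk_dist G n t) y)
      = (\<Sum>s<N. step_eigenvalue G n (z ^ s) ^ t * (z ^ s) ^ (N - y)) / of_nat N" for t
    using fourier_inversion[of y N "pmf (walk_dist G n t)"] y
      walk_dist_character[of n G] assms zN
    by (simp add: z_def N_def)
  moreover have "(\<lambda>t. (\<Sum>s<N. step_eigenvalue G n (z ^ s) ^ t * (z ^ s) ^ (N - y)) / of_nat N)
      \<longlonglongrightarrow> (\<Sum>s<N. if s = 0 then 1 else 0) / of_nat N"
  proof (intro tendsto_divide tendsto_sum tendsto_const)
    fix s assume s: "s \<in> {..<N}"
    show "(\<lambda>t. step_eigenvalue G n (z ^ s) ^ t * (z ^ s) ^ (N - y))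
        \<longlonglongrightarrow> (if s = 0 then 1 else 0)"
    proof (cases "s = 0")
      case True
      have "card (step_set G n) > 0" using \<open>n \<ge> 1\<close> by (simp add: card_gt_0_iff)
      then have "step_eigenvalue G n (z ^ s) = 1"
        using True \<open>n \<ge> 1\<close> by (simp add: step_eigenvalue_def del: One_nat_def)
      then show ?thesis using True by simp
    next
      case False
      have "norm (step_eigenvalue G n (z ^ s)) < 1"
        using norm_step_eigenvalue_less_1[of n G "z ^ s"] assms zN[of s] z1[of s] s False
        by (simp add: N_def)
      then show ?thesis
        using False tendsto_mult_left_zero[OF LIMSEQ_power_zero] by simp
    qed
  qed (use N in auto)
  ultimately have "(\<lambda>t. complex_of_real (pmf (walk_dist G n t) y)) \<longlonglongrightarrow> 1 / of_nat N"
    using N by (simp add: sum.delta)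
  then have "(\<lambda>t. Re (complex_of_real (pmf (walk_dist G n t) y))) \<longlonglongrightarrow> Re (1 / of_nat N)"
    by (rule tendsto_Re)
  then show ?thesis by (simp add: N_def Re_divide_of_nat)
qed

text \<open>
  A minimum over the empty set would say nothing about the walk; convergence to the uniform
  distribution guarantees that the defining set of times is inhabited, so its minimum belongs
  to it.
\<close>

lemma tv_dist_at_mixing_time:
  assumes "n \<ge> 1" "G 1 = 1" "G n > 1" "\<epsilon> > 0"
  shows "tv_dist {..<G n} (walk_dist G n (mixing_time G n \<epsilon>)) (pmf_of_set {..<G n}) \<le> \<epsilon>"
proof -
  have "(\<lambda>t. tv_dist {..<G n} (walk_dist G n t) (pmf_of_set {..<G n}))
      \<longlonglongrightarrow> 1 / 2 * (\<Sum>x<G n. \<bar>1 / real (G n) - pmf (pmf_of_set {..<G n}) x\<bar>)"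
    unfolding tv_dist_def
    by (intro tendsto_intros walk_dist_tendsto_uniform assms) auto
  also have "1 / 2 * (\<Sum>x<G n. \<bar>1 / real (G n) - pmf (pmf_of_set {..<G n}) x\<bar>) = 0"
    using assms by (simp add: lessThan_empty_iff)
  finally have "\<forall>\<^sub>F t in sequentially.
      tv_dist {..<G n} (walk_dist G n t) (pmf_of_set {..<G n}) < \<epsilon>"
    using \<open>\<epsilon> > 0\<close> by (rule order_tendstoD)
  then obtain t where "tv_dist {..<G n} (walk_dist G n t) (pmf_of_set {..<G n}) \<le> \<epsilon>"
    by (meson eventually_happens' less_imp_le sequentially_bot)
  then show ?thesis unfolding mixing_time_def by (rule LeastI)
qed

section \<open>The slow mode and the mixing time\<close>

text \<open>
  A nontrivial character has mean 0 under the uniform distribution and mean \<open>step_eigenvalue G n w ^ t\<close>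
  under the law at time \<open>t\<close>. As it takes values of norm 1, the means differ by at most the
  \<open>L\<^sup>1\<close> distance of the two laws.
\<close>

lemma step_eigenvalue_power_le_tv_dist:
  assumes "n \<ge> 1" "G n > 0" and w: "w ^ G n = 1" "w \<noteq> 1"
  shows "norm (step_eigenvalue G n w) ^ t
    \<le> 2 * tv_dist {..<G n} (walk_dist G n t) (pmf_of_set {..<G n})"
proof -
  have N: "G n > 0" by fact
  have nw: "norm w = 1"
    using power_eq_1_iff[OF w(1)] N by simp
  have "(\<Sum>x<G n. complex_of_real (pmf (pmf_of_set {..<G n}) x) * w ^ x) = 0"
    using w N by (simp add: lessThan_empty_iff sum_gp_strict flip: sum_divide_distrib)
  then have "step_eigenvalue G n w ^ t
      = (\<Sum>x<G n. complex_of_real (pmf (walk_dist G n t) x - pmf (pmf_of_set {..<G n}) x) * w ^ x)"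
    using walk_dist_character[of n G w t] assms
    by (simp add: left_diff_distrib sum_subtractf)
  then have "norm (step_eigenvalue G n w) ^ t
      = norm (\<Sum>x<G n. complex_of_real (pmf (walk_dist G n t) x - pmf (pmf_of_set {..<G n}) x) * w ^ x)"
    by (simp only: norm_power[symmetric])
  also have "\<dots> \<le> (\<Sum>x<G n. \<bar>pmf (walk_dist G n t) x - pmf (pmf_of_set {..<G n}) x\<bar>)"
    by (rule order_trans[OF norm_sum], rule sum_mono)
       (simp only: norm_mult norm_power nw norm_of_real power_one mult_1_right order_refl)
  finally show ?thesis by (simp add: tv_dist_def)
qed

text \<open>
  The distance from 1 to \<open>cis (2 * pi * G k / G n)\<close> is at most \<open>2 * pi * G k / G n\<close>. Summing over \<open>k\<close>
  shows that the eigenvalue, an average of such numbers, is within \<open>2 * pi * K / n\<close> of 1.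
\<close>

lemma norm_step_eigenvalue_ge:
  assumes "n \<ge> 1" "inj_on G {1..n}" and K: "(\<Sum>k=1..n. real (G k)) \<le> K * real (G n)"
    and "G n > 0"
  shows "norm (step_eigenvalue G n (cis (2 * pi / real (G n)))) \<ge> 1 - 2 * pi * K / real n"
proof -
  define w where "w = cis (2 * pi / real (G n))"
  have cis_close: "norm (1 - cis x) \<le> \<bar>x\<bar>" for x
    using iexp_approx1[of x 0] by (simp add: cis_conv_exp norm_minus_commute)
  have card: "card (step_set G n) = n"
    using assms(2) by (simp add: card_image)
  have "step_eigenvalue G n w = (\<Sum>k=1..n. w ^ G k) / of_nat n"
    unfolding step_eigenvalue_def card by (simp only: sum.reindex[OF assms(2)] o_def)
  then have "1 - step_eigenvalue G n w = (\<Sum>k=1..n. 1 - w ^ G k) / of_nat n"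
    using \<open>n \<ge> 1\<close> by (simp add: sum_subtractf diff_divide_distrib)
  also have "norm \<dots> \<le> (\<Sum>k=1..n. 2 * pi * real (G k) / real (G n)) / real n"
  proof -
    have "norm (1 - w ^ G k) \<le> 2 * pi * real (G k) / real (G n)" for k
      using cis_close[of "real (G k) * (2 * pi / real (G n))"]
      by (simp add: w_def Complex.DeMoivre mult_ac)
    then show ?thesis
      by (simp add: norm_divide divide_right_mono sum_norm_le)
  qed
  also have "\<dots> = 2 * pi * ((\<Sum>k=1..n. real (G k)) / real (G n)) / real n"
    by (simp add: sum_distrib_left sum_divide_distrib)
  also have "\<dots> \<le> 2 * pi * K / real n"
    using K \<open>G n > 0\<close> by (intro divide_right_mono mult_left_mono) (auto simp: divide_le_eq)
  finally have "norm (1 - step_eigenvalue G n w) \<le> 2 * pi * K / real n" .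
  moreover have "1 \<le> norm (1 - step_eigenvalue G n w) + norm (step_eigenvalue G n w)"
    using norm_triangle_ineq[of "1 - step_eigenvalue G n w" "step_eigenvalue G n w"] by simp
  ultimately show ?thesis by (simp add: w_def)
qed

text \<open>
  Take logarithms and use \<open>ln y \<le> y - 1\<close> at \<open>y = 1 / (1 - C / x)\<close>. The factor \<open>(x - C) / C\<close> is
  the relaxation time \<open>x / C\<close> minus 1.
\<close>

lemma time_lower_bound_of_power_le:
  fixes C b \<delta> x :: real
  assumes "0 < C" "C < x" "b \<ge> 1 - C / x" "b ^ t \<le> \<delta>" "\<delta> > 0"
  shows "real t \<ge> (x - C) / C * ln (1 / \<delta>)"
proof -
  have l0: "1 - C / x > 0" using assms by (simp add: divide_less_eq)
  have "(1 - C / x) ^ t \<le> \<delta>"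
    using power_mono[of "1 - C / x" b t] assms l0 by linarith
  then have "ln ((1 - C / x) ^ t) \<le> ln \<delta>"
    using l0 assms by (subst ln_le_cancel_iff) auto
  then have "ln (1 / \<delta>) \<le> real t * ln (1 / (1 - C / x))"
    using l0 assms by (simp add: ln_realpow ln_div)
  also have "\<dots> \<le> real t * (1 / (1 - C / x) - 1)"
    using l0 by (intro mult_left_mono ln_le_minus_one) auto
  also have "1 / (1 - C / x) - 1 = C / (x - C)"
    using assms by (simp add: field_simps)
  finally show ?thesis using assms by (simp add: field_simps)
qed

theorem theorem3p7:
  fixes G :: "nat \<Rightarrow> nat" and d :: nat and \<alpha> :: "nat \<Rightarrow> real"
  assumes "d \<ge> 1"
    and "\<And>n. n \<ge> 1 \<Longrightarrow> G n > 0"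
    and "strict_mono_on {1..} G"
    and "G 1 = 1"
    and "linear_recurrence d \<alpha> G"
    and "exponential_growth G"
  shows "\<exists>\<gamma>>0. \<forall>n>1. \<forall>\<epsilon>\<in>{0<..<1/2}.
           real (mixing_time G n \<epsilon>)
             \<ge> (real n - \<gamma> * ln (real n)) / (\<gamma> * ln (real n)) * ln (1 / (2 * \<epsilon>))"
proof -
  obtain K where "K > 0" and K: "\<And>n. n \<ge> 1 \<Longrightarrow> (\<Sum>k=1..n. real (G k)) \<le> K * real (G n)"
    using sum_le_const_mult_last[OF assms(2,3,5,6)] by blast
  define C where "C = 2 * pi * K"
  define \<gamma> where "\<gamma> = C / ln 2"
  have "C > 0" using \<open>K > 0\<close> by (simp add: C_def)
  have "real (mixing_time G n \<epsilon>)
      \<ge> (real n - \<gamma> * ln (real n)) / (\<gamma> * ln (real n)) * ln (1 / (2 * \<epsilon>))"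
    if n: "n > 1" and \<epsilon>: "\<epsilon> \<in> {0<..<1/2}" for n \<epsilon>
  proof -
    define D where "D = \<gamma> * ln (real n)"
    have "ln 2 \<le> ln (real n)" using n by simp
    then have "\<gamma> * ln 2 \<le> D"
      unfolding D_def using \<open>C > 0\<close> by (intro mult_left_mono) (auto simp: \<gamma>_def)
    then have D: "C \<le> D" by (simp add: \<gamma>_def)
    have L: "ln (1 / (2 * \<epsilon>)) > 0" using \<epsilon> by simp
    have "(real n - D) / D * ln (1 / (2 * \<epsilon>)) \<le> real (mixing_time G n \<epsilon>)"
    proof (cases "real n \<le> C")
      case True
      then have "(real n - D) / D * ln (1 / (2 * \<epsilon>)) \<le> 0"
        using D L \<open>C > 0\<close> by (intro mult_nonpos_nonneg divide_nonpos_pos) auto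
      then show ?thesis by linarith
    next
      case False
      let ?w = "cis (2 * pi / real (G n))"
      have "G n > 1"
        using strict_mono_onD[OF assms(3), of 1 n] assms(4) n by simp
      have "inj_on G {1..n}"
        using strict_mono_on_imp_inj_on[OF assms(3)] by (rule inj_on_subset) auto
      then have "norm (step_eigenvalue G n ?w) \<ge> 1 - C / real n"
        using norm_step_eigenvalue_ge[of n G K] K[of n] \<open>G n > 1\<close> n by (simp add: C_def)
      moreover have "norm (step_eigenvalue G n ?w) ^ mixing_time G n \<epsilon> \<le> 2 * \<epsilon>"
      proof -
        have "?w ^ G n = 1" "?w \<noteq> 1"
          using cis_root_power_eq_1_iff[of "G n" "G n"] cis_root_power_eq_1_iff[of "G n" 1]
            \<open>G n > 1\<close> by auto
        then show ?thesis
          using step_eigenvalue_power_le_tv_dist[of n G ?w "mixing_time G n \<epsilon>"]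
            tv_dist_at_mixing_time[of n G \<epsilon>] assms(4) \<open>G n > 1\<close> n \<epsilon> by simp
      qed
      ultimately have "(real n - C) / C * ln (1 / (2 * \<epsilon>)) \<le> real (mixing_time G n \<epsilon>)"
        using time_lower_bound_of_power_le[of C "real n"] \<open>C > 0\<close> False \<epsilon> by simp
      moreover have "(real n - D) / D \<le> (real n - C) / C"
      proof -
        have "real n / D \<le> real n / C" using D \<open>C > 0\<close> by (intro divide_left_mono) auto
        then show ?thesis using D \<open>C > 0\<close> by (simp add: diff_divide_distrib)
      qed
      ultimately show ?thesis
        using mult_right_mono[of "(real n - D) / D" "(real n - C) / C" "ln (1 / (2 * \<epsilon>))"] L
        by linarith
    qed
    then show ?thesis by (simp add: D_def)
  qed
  moreover have "\<gamma> > 0" using \<open>C > 0\<close> by (simp add: \<gamma>_def)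
  ultimately show ?thesis by blast
qed

end
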